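(* There is a one-to-one correspondence between skeletal 2-term $HL_\infty$-algebras and tuples $((\mathfrak g,[\cdot,\cdot]_{\mathfrak g},\phi_{\mathfrak g}),W,A,\rho_A,\theta)$, where $(\mathfrak g,[\cdot,\cdot]_{\mathfrak g},\phi_{\mathfrak g})$ is a hom-Lie algebra, $W$ is a vector space, $A\in\mathfrak{gl}(W)$, $\rho_A:\mathfrak g\to\mathfrak{gl}(W)$ is a representation of $\mathfrak g$ on $W$ with respect to $A$, and $\theta$ is a 3-hom-cocycle of the hom-Lie algebra $\mathfrak g$ with coefficients in the representation $\rho_A$.
   Context: All vector spaces are over a fixed ground field of characteristic zero (e.g. $\mathbb R$); $\mathfrak{gl}(W)$ denotes all linear endomorphisms of $W$. **Hom-Lie algebra.** A triple $(\mathfrak g,[\cdot,\cdot]_{\mathfrak g},\phi_{\mathfrak g})$ of a vector space, a skew-symmetric bilinear bracket and a linear map $\phi_{\mathfrak g}:\mathfrak g\to\mathfrak g$ with $\phi_{\mathfrak g}[u,v]_{\mathfrak g}=[\phi_{\mathfrak g}(u),\phi_{\mathfrak g}(v)]_{\mathfrak g}$ and $[\phi_{\mathfrak g}(u),[v,w]_{\mathfrak g}]_{\mathfrak g}+[\phi_{\mathfrak g}(v),[w,u]_{\mathfrak g}]_{\mathfrak g}+[\phi_{\mathfrak g}(w),[u,v]_{\mathfrak g}]_{\mathfrak g}=0$. **Representation.** A representation of $\mathfrak g$ on $W$ with respect to $A\in\mathfrak{gl}(W)$ is a linear map $\rho_A:\mathfrak g\to\mathfrak{gl}(W)$ with $\rho_A(\phi_{\mathfrak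 g}(u))\circ A=A\circ\rho_A(u)$ and $\rho_A([u,v]_{\mathfrak g})\circ A=\rho_A(\phi_{\mathfrak g}(u))\circ\rho_A(v)-\rho_A(\phi_{\mathfrak g}(v))\circ\rho_A(u)$. **Hom-cocycles.** A $k$-hom-cochain is a skew-symmetric $k$-linear map $f:\wedge^k\mathfrak g\to W$ with $A(f(u_1,\dots,u_k))=f(\phi_{\mathfrak g}(u_1),\dots,\phi_{\mathfrak g}(u_k))$. The coboundary is $$d_{\rho_A}f(u_1,\dots,u_{k+1})=\sum_{i=1}^{k+1}(-1)^{i+1}\rho_A(\phi_{\mathfrak g}^{k-1}(u_i))(f(u_1,\dots,\widehat{u_i},\dots,u_{k+1}))+\sum_{i<j}(-1)^{i+j}f([u_i,u_j]_{\mathfrak g},\phi_{\mathfrak g}(u_1),\dots,\widehat{u_i},\dots,\widehat{u_j},\dots,\phi_{\mathfrak g}(u_{k+1})),$$ where in the second sum $\phi_{\mathfrak g}$ is applied to every argument after the first. A $k$-hom-cocycle is a $k$-hom-cochain $f$ with $d_{\rho_A}f=0$. **2-term $HL_\infty$-algebras.** A 2-term $HL_\infty$-algebra $(V_1\xrightarrow{d}V_0,l_2,l_3,\phi_0,\phi_1)$ consists of a linear map $d:V_1\to V_0$; bilinear maps $l_2:V_i\times V_j\to V_{i+j}$ ($i,j\in\{0,1\}$, $V_2=0$); linear maps $\phi_0:V_0\to V_0$, $\phi_1:V_1\to V_1$ with $\phi_0\circ d=d\circ\phi_1$; and a skew-symmetric trilinear map $l_3:V_0\times V_0\times V_0\to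 V_1$ with $l_3(\phi_0(x),\phi_0(y),\phi_0(z))=\phi_1(l_3(x,y,z))$, such that for all $w,x,y,z\in V_0$, $m,n\in V_1$: (a) $l_2(x,y)=-l_2(y,x)$; (b) $l_2(x,m)=-l_2(m,x)$; (c) $l_2(m,n)=0$; (d) $d\,l_2(x,m)=l_2(x,dm)$; (e) $l_2(dm,n)=l_2(m,dn)$; (f) $\phi_0(l_2(x,y))=l_2(\phi_0(x),\phi_0(y))$; (g) $\phi_1(l_2(x,m))=l_2(\phi_0(x),\phi_1(m))$; (h) $d\,l_3(x,y,z)=l_2(\phi_0(x),l_2(y,z))+l_2(\phi_0(y),l_2(z,x))+l_2(\phi_0(z),l_2(x,y))$; (i) $l_3(x,y,dm)=l_2(\phi_0(x),l_2(y,m))+l_2(\phi_0(y),l_2(m,x))+l_2(\phi_1(m),l_2(x,y))$; (j) $l_3(l_2(w,x),\phi_0(y),\phi_0(z))+l_2(l_3(w,x,z),\phi_0^2(y))+l_3(\phi_0(w),l_2(x,z),\phi_0(y))+l_3(l_2(w,z),\phi_0(x),\phi_0(y))=l_2(l_3(w,x,y),\phi_0^2(z))+l_3(l_2(w,y),\phi_0(x),\phi_0(z))+l_3(\phi_0(w),l_2(x,y),\phi_0(z))+l_2(\phi_0^2(w),l_3(x,y,z))+l_2(l_3(w,y,z),\phi_0^2(x))+l_3(\phi_0(w),l_2(y,z),\phi_0(x))$. It is *skeletal* if $d=0$. **The correspondence meant.** A skeletal 2-term $HL_\infty$-algebra is sent to $((V_0,l_2|_{V_0\times V_0},\phi_0),V_1,\phi_1,\rho_{\phi_1},l_3)$,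 where $\rho_{\phi_1}(x)(m)=l_2(x,m)$ for $x\in V_0$, $m\in V_1$. *)

theory Defs
  imports Complex_Main
begin

text \<open>
  Vector spaces over a ground field \<open>'k\<close> of characteristic zero are given by the library locale
  \<^locale>\<open>vector_space\<close>, i.e. by a scalar multiplication on a type of class
  \<^class>\<open>ab_group_add\<close>. Linear endomorphisms are functions satisfying
  \<^const>\<open>Vector_Spaces.linear\<close>.
\<close>

definition bilinear_map ::
  "('k::field \<Rightarrow> 'a::ab_group_add \<Rightarrow> 'a) \<Rightarrow> ('k \<Rightarrow> 'b::ab_group_add \<Rightarrow> 'b) \<Rightarrow>
   ('k \<Rightarrow> 'c::ab_group_add \<Rightarrow> 'c) \<Rightarrow> ('a \<Rightarrow> 'b \<Rightarrow> 'c) \<Rightarrow> bool"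
where
  "bilinear_map sa sb sc f \<longleftrightarrow>
     (\<forall>x. Vector_Spaces.linear sb sc (f x)) \<and> (\<forall>y. Vector_Spaces.linear sa sc (\<lambda>x. f x y))"

text \<open>
  A function of \<open>k\<close> arguments is represented by a function on lists, of which only the values on
  lists of length \<open>k\<close> matter. Argument positions are counted from 0.
\<close>

definition multilinear_map ::
  "('k::field \<Rightarrow> 'a::ab_group_add \<Rightarrow> 'a) \<Rightarrow> ('k \<Rightarrow> 'b::ab_group_add \<Rightarrow> 'b) \<Rightarrow>
   nat \<Rightarrow> ('a list \<Rightarrow> 'b) \<Rightarrow> bool"
where
  "multilinear_map sa sb k f \<longleftrightarrow>
     (\<forall>us i. length us = k \<longrightarrow> i < k \<longrightarrow> Vector_Spaces.linear sa sb (\<lambda>x. f (us[i := x])))"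

definition skew_symmetric_map :: "nat \<Rightarrow> ('a list \<Rightarrow> 'b::ab_group_add) \<Rightarrow> bool"
where
  "skew_symmetric_map k f \<longleftrightarrow>
     (\<forall>us i j. length us = k \<longrightarrow> i < j \<longrightarrow> j < k \<longrightarrow> f (us[i := us ! j, j := us ! i]) = - f us)"

definition on_list3 :: "('a \<Rightarrow> 'a \<Rightarrow> 'a \<Rightarrow> 'b) \<Rightarrow> 'a list \<Rightarrow> 'b"
where
  "on_list3 f us = f (us ! 0) (us ! 1) (us ! 2)"

locale hom_Lie_algebra = vector_space scale
  for scale :: "'k::field_char_0 \<Rightarrow> 'g::ab_group_add \<Rightarrow> 'g" +
  fixes bracket :: "'g \<Rightarrow> 'g \<Rightarrow> 'g" and \<phi> :: "'g \<Rightarrow> 'g"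
  assumes bilinear_bracket: "bilinear_map scale scale scale bracket"
    and skew_bracket: "bracket u v = - bracket v u"
    and linear_\<phi>: "Vector_Spaces.linear scale scale \<phi>"
    and \<phi>_bracket: "\<phi> (bracket u v) = bracket (\<phi> u) (\<phi> v)"
    and hom_Jacobi:
      "bracket (\<phi> u) (bracket v w) + bracket (\<phi> v) (bracket w u) + bracket (\<phi> w) (bracket u v) = 0"

text \<open>
  The vector space structure on endomorphisms is pointwise, so linearity of
  \<open>\<rho> : \<gg> \<rightarrow> \<gg>\<ll>(W)\<close> together with linearity of each \<open>\<rho> u\<close> is bilinearity of
  \<open>(u, m) \<mapsto> \<rho> u m\<close>.
\<close>

locale hom_Lie_representation = hom_Lie_algebra scale bracket \<phi> + W: vector_space scaleW
  for scale :: "'k::field_char_0 \<Rightarrow> 'g::ab_group_add \<Rightarrow> 'g" and bracket \<phi>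
    and scaleW :: "'k \<Rightarrow> 'w::ab_group_add \<Rightarrow> 'w" +
  fixes A :: "'w \<Rightarrow> 'w" and \<rho> :: "'g \<Rightarrow> 'w \<Rightarrow> 'w"
  assumes linear_A: "Vector_Spaces.linear scaleW scaleW A"
    and linear_\<rho>: "bilinear_map scale scaleW scaleW \<rho>"
    and \<rho>_\<phi>: "\<rho> (\<phi> u) \<circ> A = A \<circ> \<rho> u"
    and \<rho>_bracket: "\<rho> (bracket u v) (A m) = \<rho> (\<phi> u) (\<rho> v m) - \<rho> (\<phi> v) (\<rho> u m)"

definition hom_cochain ::
  "('k::field_char_0 \<Rightarrow> 'g::ab_group_add \<Rightarrow> 'g) \<Rightarrow> ('g \<Rightarrow> 'g) \<Rightarrow>
   ('k \<Rightarrow> 'w::ab_group_add \<Rightarrow> 'w) \<Rightarrow> ('w \<Rightarrow> 'w) \<Rightarrow> nat \<Rightarrow> ('g list \<Rightarrow> 'w) \<Rightarrow> bool"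
where
  "hom_cochain scale \<phi> scaleW A k f \<longleftrightarrow>
     multilinear_map scale scaleW k f \<and> skew_symmetric_map k f \<and>
     (\<forall>us. length us = k \<longrightarrow> A (f us) = f (map \<phi> us))"

text \<open>
  The coboundary of a \<open>k\<close>-hom-cochain, \<open>k \<ge> 1\<close>, evaluated on a list of length \<open>k + 1\<close>.
  \<^term>\<open>nths us (- {i, j})\<close> is \<open>us\<close> with the entries at positions \<open>i\<close> and \<open>j\<close> omitted. Since positions
  start at 0, the sign \<open>(-1)^(i+1)\<close> of the usual formula becomes \<open>(-1)^i\<close>, while \<open>(-1)^(i+j)\<close> is
  unaffected.
\<close>

definition hom_coboundary ::
  "('g \<Rightarrow> 'g \<Rightarrow> 'g) \<Rightarrow> ('g \<Rightarrow> 'g) \<Rightarrow> ('k::field_char_0 \<Rightarrow> 'w::ab_group_add \<Rightarrow> 'w) \<Rightarrow>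
   ('g \<Rightarrow> 'w \<Rightarrow> 'w) \<Rightarrow> nat \<Rightarrow> ('g list \<Rightarrow> 'w) \<Rightarrow> 'g list \<Rightarrow> 'w"
where
  "hom_coboundary bracket \<phi> scaleW \<rho> k f us =
     (\<Sum>i<k + 1. scaleW ((- 1) ^ i) (\<rho> ((\<phi> ^^ (k - 1)) (us ! i)) (f (nths us (- {i}))))) +
     (\<Sum>j<k + 1. \<Sum>i<j. scaleW ((- 1) ^ (i + j))
        (f (bracket (us ! i) (us ! j) # map \<phi> (nths us (- {i, j})))))"

definition hom_cocycle ::
  "('k::field_char_0 \<Rightarrow> 'g::ab_group_add \<Rightarrow> 'g) \<Rightarrow> ('g \<Rightarrow> 'g \<Rightarrow> 'g) \<Rightarrow> ('g \<Rightarrow> 'g) \<Rightarrow>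
   ('k \<Rightarrow> 'w::ab_group_add \<Rightarrow> 'w) \<Rightarrow> ('w \<Rightarrow> 'w) \<Rightarrow> ('g \<Rightarrow> 'w \<Rightarrow> 'w) \<Rightarrow>
   nat \<Rightarrow> ('g list \<Rightarrow> 'w) \<Rightarrow> bool"
where
  "hom_cocycle scale bracket \<phi> scaleW A \<rho> k f \<longleftrightarrow>
     hom_cochain scale \<phi> scaleW A k f \<and>
     (\<forall>us. length us = k + 1 \<longrightarrow> hom_coboundary bracket \<phi> scaleW \<rho> k f us = 0)"

text \<open>
  The bracket \<open>l\<^sub>2\<close> has one component for each pair of degrees. The component on
  \<open>V\<^sub>1 \<times> V\<^sub>1\<close> takes values in \<open>V\<^sub>2 = 0\<close>, which is rendered as the one-element type
  \<^typ>\<open>unit\<close>; it carries no information.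
\<close>

record ('v0, 'v1) HL_data =
  differential :: "'v1 \<Rightarrow> 'v0"
  l2_00 :: "'v0 \<Rightarrow> 'v0 \<Rightarrow> 'v0"
  l2_01 :: "'v0 \<Rightarrow> 'v1 \<Rightarrow> 'v1"
  l2_10 :: "'v1 \<Rightarrow> 'v0 \<Rightarrow> 'v1"
  l2_11 :: "'v1 \<Rightarrow> 'v1 \<Rightarrow> unit"
  l3 :: "'v0 \<Rightarrow> 'v0 \<Rightarrow> 'v0 \<Rightarrow> 'v1"
  phi0 :: "'v0 \<Rightarrow> 'v0"
  phi1 :: "'v1 \<Rightarrow> 'v1"

locale HL_infinity_2term = V0: vector_space scale0 + V1: vector_space scale1
  for scale0 :: "'k::field_char_0 \<Rightarrow> 'v0::ab_group_add \<Rightarrow> 'v0"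
    and scale1 :: "'k \<Rightarrow> 'v1::ab_group_add \<Rightarrow> 'v1" +
  fixes L :: "('v0, 'v1) HL_data"
  assumes linear_diff: "Vector_Spaces.linear scale1 scale0 (differential L)"
    and bilinear_l2_00: "bilinear_map scale0 scale0 scale0 (l2_00 L)"
    and bilinear_l2_01: "bilinear_map scale0 scale1 scale1 (l2_01 L)"
    and bilinear_l2_10: "bilinear_map scale1 scale0 scale1 (l2_10 L)"
    and linear_phi0: "Vector_Spaces.linear scale0 scale0 (phi0 L)"
    and linear_phi1: "Vector_Spaces.linear scale1 scale1 (phi1 L)"
    and phi0_diff: "phi0 L \<circ> differential L = differential L \<circ> phi1 L"
    and trilinear_l3: "multilinear_map scale0 scale1 3 (on_list3 (l3 L))"
    and skew_l3: "skew_symmetric_map 3 (on_list3 (l3 L))"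
    and phi_l3: "l3 L (phi0 L x) (phi0 L y) (phi0 L z) = phi1 L (l3 L x y z)"
    and a: "l2_00 L x y = - l2_00 L y x"
    and b: "l2_01 L x m = - l2_10 L m x"
    and c: "l2_11 L m n = ()"
    and d: "differential L (l2_01 L x m) = l2_00 L x (differential L m)"
    and e: "l2_01 L (differential L m) n = l2_10 L m (differential L n)"
    and f: "phi0 L (l2_00 L x y) = l2_00 L (phi0 L x) (phi0 L y)"
    and g: "phi1 L (l2_01 L x m) = l2_01 L (phi0 L x) (phi1 L m)"
    and h: "differential L (l3 L x y z) =
       l2_00 L (phi0 L x) (l2_00 L y z) + l2_00 L (phi0 L y) (l2_00 L z x)
       + l2_00 L (phi0 L z) (l2_00 L x y)"
    and i: "l3 L x y (differential L m) =
       l2_01 L (phi0 L x) (l2_01 L y m) + l2_01 L (phi0 L y) (l2_10 L m x)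
       + l2_10 L (phi1 L m) (l2_00 L x y)"
    and j: "l3 L (l2_00 L w x) (phi0 L y) (phi0 L z) + l2_10 L (l3 L w x z) ((phi0 L ^^ 2) y)
       + l3 L (phi0 L w) (l2_00 L x z) (phi0 L y) + l3 L (l2_00 L w z) (phi0 L x) (phi0 L y)
       = l2_10 L (l3 L w x y) ((phi0 L ^^ 2) z) + l3 L (l2_00 L w y) (phi0 L x) (phi0 L z)
       + l3 L (phi0 L w) (l2_00 L x y) (phi0 L z) + l2_01 L ((phi0 L ^^ 2) w) (l3 L x y z)
       + l2_10 L (l3 L w y z) ((phi0 L ^^ 2) x) + l3 L (phi0 L w) (l2_00 L y z) (phi0 L x)"

definition skeletal :: "('v0::zero, 'v1) HL_data \<Rightarrow> bool"
where
  "skeletal L \<longleftrightarrow> differential L = (\<lambda>_. 0)"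

definition skeletal_HL_infinity_algebras ::
  "('k::field_char_0 \<Rightarrow> 'v0::ab_group_add \<Rightarrow> 'v0) \<Rightarrow> ('k \<Rightarrow> 'v1::ab_group_add \<Rightarrow> 'v1) \<Rightarrow>
   ('v0, 'v1) HL_data set"
where
  "skeletal_HL_infinity_algebras scale0 scale1 =
     {L. HL_infinity_2term scale0 scale1 L \<and> skeletal L}"

text \<open>
  The underlying vector spaces \<open>\<gg>\<close> and \<open>W\<close> are the parameters \<open>scale\<close> and \<open>scaleW\<close>; the tuples
  hold the structure maps on them.
\<close>

definition hom_Lie_3_cocycle_tuples ::
  "('k::field_char_0 \<Rightarrow> 'g::ab_group_add \<Rightarrow> 'g) \<Rightarrow> ('k \<Rightarrow> 'w::ab_group_add \<Rightarrow> 'w) \<Rightarrow>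
   ((('g \<Rightarrow> 'g \<Rightarrow> 'g) \<times> ('g \<Rightarrow> 'g)) \<times> ('w \<Rightarrow> 'w) \<times> ('g \<Rightarrow> 'w \<Rightarrow> 'w) \<times> ('g \<Rightarrow> 'g \<Rightarrow> 'g \<Rightarrow> 'w)) set"
where
  "hom_Lie_3_cocycle_tuples scale scaleW =
     {((bracket, \<phi>), A, \<rho>, \<theta>).
        hom_Lie_algebra scale bracket \<phi> \<and>
        hom_Lie_representation scale bracket \<phi> scaleW A \<rho> \<and>
        hom_cocycle scale bracket \<phi> scaleW A \<rho> 3 (on_list3 \<theta>)}"

definition skeletal_to_tuple ::
  "('v0, 'v1) HL_data \<Rightarrow>
   (('v0 \<Rightarrow> 'v0 \<Rightarrow> 'v0) \<times> ('v0 \<Rightarrow> 'v0)) \<times> ('v1 \<Rightarrow> 'v1) \<times> ('v0 \<Rightarrow> 'v1 \<Rightarrow> 'v1) \<times>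
   ('v0 \<Rightarrow> 'v0 \<Rightarrow> 'v0 \<Rightarrow> 'v1)"
where
  "skeletal_to_tuple L = ((l2_00 L, phi0 L), phi1 L, (\<lambda>x m. l2_01 L x m), l3 L)"

end

theory Submission imports Defs begin

text \<open>Once d = 0, the axioms of a 2-term HL-infinity algebra split into the conditions on a
  tuple. Bilinearity of \<open>l2_00\<close> with (a), (f), (h) makes V0 a hom-Lie algebra; (g) and
  (i) make \<open>l2_01\<close> a representation with respect to \<open>phi1\<close>; the conditions
  on \<open>l3\<close> alone make it a 3-hom-cochain, and (j) makes it closed. In (d) and (e) both
  sides vanish. \<open>skeletal_HL_infinity_iff\<close> proves this equivalence, with
  \<open>hom_coboundary_on_list3\<close> supplying the ten-term form of the coboundary that is
  compared with (j).

  Passing to the tuple loses nothing: \<open>differential\<close> is zero, \<open>l2_10\<close> is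
  minus \<open>l2_01\<close> by (b), and \<open>l2_11\<close> takes values in \<open>unit\<close>.
  So \<open>tuple_to_skeletal\<close>, which restores these components, is a two-sided
  inverse.\<close>

lemma on_list3_simp [simp]: "on_list3 f [x, y, z] = f x y z"
  by (simp add: on_list3_def)

lemma skew_symmetric_on_list3_swap:
  assumes "skew_symmetric_map 3 (on_list3 f)"
  shows "f y x z = - f x y z"
proof -
  have "on_list3 f ([x, y, z][0 := [x, y, z] ! 1, 1 := [x, y, z] ! 0]) = - on_list3 f [x, y, z]"
    using assms[unfolded skew_symmetric_map_def, rule_format, of "[x, y, z]" 0 1] by simp
  then show ?thesis by simp
qed

lemma hom_cochain_on_list3_iff:
  "hom_cochain scale \<phi> scaleW A 3 (on_list3 f) \<longleftrightarrow>
     multilinear_map scale scaleW 3 (on_list3 f) \<and> skew_symmetric_map 3 (on_list3 f) \<and>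
     (\<forall>x y z. A (f x y z) = f (\<phi> x) (\<phi> y) (\<phi> z))"
proof -
  have "(\<forall>us. length us = 3 \<longrightarrow> A (on_list3 f us) = on_list3 f (map \<phi> us)) \<longleftrightarrow>
        (\<forall>x y z. A (f x y z) = f (\<phi> x) (\<phi> y) (\<phi> z))"
    by (fastforce simp: length_Suc_conv numeral_3_eq_3 dest: spec[of _ "[_, _, _]"])
  then show ?thesis by (simp add: hom_cochain_def)
qed

text \<open>For k = 3 the first sum has four terms, acting through the power k - 1 = 2 of \<phi>,
  and the second has six, one for each pair i < j. Unrolling both sums and evaluating
  \<open>nths\<close> leaves only the signs, which the vector space laws turn into plus and
  minus.\<close>

lemma hom_coboundary_on_list3:
  fixes scaleW :: "'k::field_char_0 \<Rightarrow> 'w::ab_group_add \<Rightarrow> 'w"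
  assumes "vector_space scaleW"
  shows "hom_coboundary bracket \<phi> scaleW \<rho> 3 (on_list3 f) [w, x, y, z] =
      \<rho> ((\<phi> ^^ 2) w) (f x y z) - \<rho> ((\<phi> ^^ 2) x) (f w y z)
      + \<rho> ((\<phi> ^^ 2) y) (f w x z) - \<rho> ((\<phi> ^^ 2) z) (f w x y)
      - f (bracket w x) (\<phi> y) (\<phi> z) + f (bracket w y) (\<phi> x) (\<phi> z)
      - f (bracket w z) (\<phi> x) (\<phi> y) - f (bracket x y) (\<phi> w) (\<phi> z)
      + f (bracket x z) (\<phi> w) (\<phi> y) - f (bracket y z) (\<phi> w) (\<phi> x)"
proof -
  interpret vector_space scaleW by fact
  show ?thesis
    by (simp add: hom_coboundary_def eval_nat_numeral nths_Cons scale_minus_left algebra_simps)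
qed

lemma hom_cocycle_on_list3_iff:
  "hom_cocycle scale bracket \<phi> scaleW A \<rho> 3 (on_list3 f) \<longleftrightarrow>
     hom_cochain scale \<phi> scaleW A 3 (on_list3 f) \<and>
     (\<forall>w x y z. hom_coboundary bracket \<phi> scaleW \<rho> 3 (on_list3 f) [w, x, y, z] = 0)"
  by (auto simp: hom_cocycle_def length_Suc_conv eval_nat_numeral)

lemma bilinear_map_linear:
  assumes "bilinear_map sa sb sc f"
  shows "Vector_Spaces.linear sb sc (f x)" "Vector_Spaces.linear sa sc (\<lambda>x. f x y)"
  using assms by (auto simp: bilinear_map_def)

lemma linear_uminus:
  assumes "Vector_Spaces.linear sa sb f"
  shows "Vector_Spaces.linear sa sb (\<lambda>x. - f x)"
proof -
  interpret Vector_Spaces.linear sa sb f by fact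
  show ?thesis
    by unfold_locales (simp_all add: add scale)
qed

lemma linear_map_zero:
  assumes "Vector_Spaces.linear sa sb f" shows "f 0 = 0"
proof -
  interpret Vector_Spaces.linear sa sb f by fact
  show ?thesis by (rule zero)
qed

text \<open>Evaluates the left side of (i), where the last argument is dm = 0.\<close>

lemma multilinear_on_list3_zero:
  assumes "multilinear_map sa sb 3 (on_list3 f)"
  shows "f x y 0 = 0"
proof -
  have "Vector_Spaces.linear sa sb (\<lambda>t. on_list3 f ([x, y, 0][2 := t]))"
    using assms[unfolded multilinear_map_def, rule_format, of "[x, y, 0]" 2] by simp
  from linear_map_zero[OF this] show ?thesis by (simp add: numeral_2_eq_2)
qed

lemma linear_map_uminus:
  assumes "Vector_Spaces.linear sa sb f" shows "f (- x) = - f x"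
proof -
  interpret Vector_Spaces.linear sa sb f by fact
  show ?thesis by (rule neg)
qed

lemma linear_const_zero:
  assumes "vector_space sa" "vector_space sb"
  shows "Vector_Spaces.linear sa sb (\<lambda>_. 0)"
proof -
  interpret vector_space_pair sa sb using assms by (simp add: vector_space_pair_def)
  show ?thesis by (rule linear_zero)
qed

text \<open>
  With \<open>d = 0\<close>, (h) is the hom-Jacobi identity, (g) and (i) are the two axioms of a representation,
  and (j) reads \<open>d\<^sub>\<rho> l\<^sub>3 = 0\<close> up to sign, after \<open>\<phi>\<^sub>0 w\<close> has been moved to the second argument
  of \<open>l\<^sub>3\<close>.
\<close>

lemma skeletal_HL_infinity_iff:
  fixes scale0 :: "'k::field_char_0 \<Rightarrow> 'v0::ab_group_add \<Rightarrow> 'v0"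
    and scale1 :: "'k \<Rightarrow> 'v1::ab_group_add \<Rightarrow> 'v1"
  assumes V0: "vector_space scale0" and V1: "vector_space scale1"
    and skel: "differential L = (\<lambda>_. 0)"
  shows "HL_infinity_2term scale0 scale1 L \<longleftrightarrow>
      l2_10 L = (\<lambda>m x. - l2_01 L x m) \<and>
      skeletal_to_tuple L \<in> hom_Lie_3_cocycle_tuples scale0 scale1"
proof (intro iffI conjI)
  assume "HL_infinity_2term scale0 scale1 L"
  then interpret HL: HL_infinity_2term scale0 scale1 L .
  have l2_10: "l2_10 L m x = - l2_01 L x m" for m x
    by (simp add: HL.b)
  show "l2_10 L = (\<lambda>m x. - l2_01 L x m)"
    by (intro ext) (rule l2_10)
  have l3_0: "l3 L x y 0 = 0" for x y
    by (rule multilinear_on_list3_zero) (rule HL.trilinear_l3)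
  have "hom_Lie_algebra scale0 (l2_00 L) (phi0 L)"
  proof (intro hom_Lie_algebra.intro hom_Lie_algebra_axioms.intro V0)
    show "l2_00 L u v = - l2_00 L v u" for u v by (rule HL.a)
    show "l2_00 L (phi0 L u) (l2_00 L v w) + l2_00 L (phi0 L v) (l2_00 L w u)
        + l2_00 L (phi0 L w) (l2_00 L u v) = 0" for u v w
      using HL.h[of u v w] by (simp add: skel)
  qed (use HL.bilinear_l2_00 HL.linear_phi0 HL.f in simp_all)
  moreover have "hom_Lie_representation scale0 (l2_00 L) (phi0 L) scale1 (phi1 L) (l2_01 L)"
  proof (intro hom_Lie_representation.intro hom_Lie_representation_axioms.intro V1)
    show "l2_01 L (phi0 L u) \<circ> phi1 L = phi1 L \<circ> l2_01 L u" for u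
      by (simp add: fun_eq_iff HL.g)
    show "l2_01 L (l2_00 L u v) (phi1 L m) =
        l2_01 L (phi0 L u) (l2_01 L v m) - l2_01 L (phi0 L v) (l2_01 L u m)" for u v m
      \<comment> \<open>The left side of (i) is \<open>l3 L u v 0 = 0\<close>. On the right each
        \<open>l2_10\<close> becomes minus an action; the inner sign is pulled out by linearity of
        the action of \<open>phi0 L v\<close>.\<close>
      using HL.i[of u v m]
      by (simp add: skel l3_0 l2_10 linear_map_uminus[OF bilinear_map_linear(1)[OF HL.bilinear_l2_01]]
          algebra_simps)
  qed (use \<open>hom_Lie_algebra _ _ _\<close> HL.linear_phi1 HL.bilinear_l2_01 in simp_all)
  moreover have "hom_cocycle scale0 (l2_00 L) (phi0 L) scale1 (phi1 L) (l2_01 L) 3 (on_list3 (l3 L))"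
    unfolding hom_cocycle_on_list3_iff hom_cochain_on_list3_iff
  proof (intro conjI allI)
    fix w x y z
    show "hom_coboundary (l2_00 L) (phi0 L) scale1 (l2_01 L) 3 (on_list3 (l3 L)) [w, x, y, z] = 0"
      \<comment> \<open>In (j) three terms carry the bracket in the second slot, while the
        coboundary always has it first. Skewness is instantiated for exactly that shape: as an
        unrestricted rewrite rule the swap would apply to its own result. Then left minus right side
        of (j) is minus the coboundary.\<close>
      using HL.j[of w x y z]
      by (simp add: hom_coboundary_on_list3[OF V1] l2_10 algebra_simps
          skew_symmetric_on_list3_swap[OF HL.skew_l3, of "phi0 L w" "l2_00 L _ _"])
  qed (use HL.trilinear_l3 HL.skew_l3 HL.phi_l3 in simp_all)
  ultimately show "skeletal_to_tuple L \<in> hom_Lie_3_cocycle_tuples scale0 scale1"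
    by (simp add: skeletal_to_tuple_def hom_Lie_3_cocycle_tuples_def)
next
  assume "l2_10 L = (\<lambda>m x. - l2_01 L x m) \<and>
      skeletal_to_tuple L \<in> hom_Lie_3_cocycle_tuples scale0 scale1"
  then have l2_10: "l2_10 L = (\<lambda>m x. - l2_01 L x m)"
    and rep: "hom_Lie_representation scale0 (l2_00 L) (phi0 L) scale1 (phi1 L) (l2_01 L)"
    and coc: "hom_cocycle scale0 (l2_00 L) (phi0 L) scale1 (phi1 L) (l2_01 L) 3 (on_list3 (l3 L))"
    by (auto simp: skeletal_to_tuple_def hom_Lie_3_cocycle_tuples_def)
  interpret R: hom_Lie_representation scale0 "l2_00 L" "phi0 L" scale1 "phi1 L" "l2_01 L"
    by (fact rep)
  note rho = bilinear_map_linear[OF R.linear_\<rho>]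
  note bracket = bilinear_map_linear[OF R.bilinear_bracket]
  from coc have trilinear: "multilinear_map scale0 scale1 3 (on_list3 (l3 L))"
    and skew: "skew_symmetric_map 3 (on_list3 (l3 L))"
    and phi: "phi1 L (l3 L x y z) = l3 L (phi0 L x) (phi0 L y) (phi0 L z)"
    and cob: "hom_coboundary (l2_00 L) (phi0 L) scale1 (l2_01 L) 3 (on_list3 (l3 L)) [w, x, y, z] = 0"
    for w x y z
    by (auto simp: hom_cocycle_on_list3_iff hom_cochain_on_list3_iff)
  have l3_0: "l3 L x y 0 = 0" for x y
    by (rule multilinear_on_list3_zero) (rule trilinear)
  show "HL_infinity_2term scale0 scale1 L"
  proof (intro HL_infinity_2term.intro HL_infinity_2term_axioms.intro V0 V1)
    show "Vector_Spaces.linear scale1 scale0 (differential L)"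
      unfolding skel by (rule linear_const_zero[OF V1 V0])
    show "bilinear_map scale1 scale0 scale1 (l2_10 L)"
      unfolding l2_10 bilinear_map_def by (intro conjI allI linear_uminus rho)
    show "phi0 L \<circ> differential L = differential L \<circ> phi1 L"
      by (simp add: skel fun_eq_iff linear_map_zero[OF R.linear_\<phi>])
    show "l2_00 L x y = - l2_00 L y x" for x y by (rule R.skew_bracket)
    show "differential L (l2_01 L x m) = l2_00 L x (differential L m)" for x m
      by (simp add: skel linear_map_zero[OF bracket(1)])
    show "l2_01 L (differential L m) n = l2_10 L m (differential L n)" for m n
      by (simp add: skel l2_10 linear_map_zero[OF rho(2)])
    show "phi1 L (l2_01 L x m) = l2_01 L (phi0 L x) (phi1 L m)" for x m
      using R.\<rho>_\<phi>[of x] by (simp add: fun_eq_iff)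
    show "differential L (l3 L x y z) = l2_00 L (phi0 L x) (l2_00 L y z)
        + l2_00 L (phi0 L y) (l2_00 L z x) + l2_00 L (phi0 L z) (l2_00 L x y)" for x y z
      by (simp add: skel R.hom_Jacobi)
    show "l3 L x y (differential L m) = l2_01 L (phi0 L x) (l2_01 L y m)
        + l2_01 L (phi0 L y) (l2_10 L m x) + l2_10 L (phi1 L m) (l2_00 L x y)" for x y m
      by (simp add: skel l3_0 l2_10 R.\<rho>_bracket linear_map_uminus[OF rho(1)])
    show "l3 L (l2_00 L w x) (phi0 L y) (phi0 L z) + l2_10 L (l3 L w x z) ((phi0 L ^^ 2) y)
        + l3 L (phi0 L w) (l2_00 L x z) (phi0 L y) + l3 L (l2_00 L w z) (phi0 L x) (phi0 L y)
        = l2_10 L (l3 L w x y) ((phi0 L ^^ 2) z) + l3 L (l2_00 L w y) (phi0 L x) (phi0 L z)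
        + l3 L (phi0 L w) (l2_00 L x y) (phi0 L z) + l2_01 L ((phi0 L ^^ 2) w) (l3 L x y z)
        + l2_10 L (l3 L w y z) ((phi0 L ^^ 2) x) + l3 L (phi0 L w) (l2_00 L y z) (phi0 L x)"
      for w x y z
      \<comment> \<open>The same comparison, read backwards: the vanishing coboundary yields
        (j).\<close>
      using cob[of w x y z]
      by (simp add: hom_coboundary_on_list3[OF V1] l2_10 algebra_simps
          skew_symmetric_on_list3_swap[OF skew, of "phi0 L w" "l2_00 L _ _"])
  qed (use R.bilinear_bracket R.linear_\<rho> R.linear_\<phi> R.linear_A trilinear skew phi R.\<phi>_bracket
      in \<open>simp_all add: l2_10\<close>)
qed

text \<open>The components absent from the tuple receive the only values possible: zero because the
  algebra is to be skeletal, minus the action because of (b), and the unique map into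
  \<open>unit\<close>.\<close>

definition tuple_to_skeletal ::
  "(('v0 \<Rightarrow> 'v0 \<Rightarrow> 'v0) \<times> ('v0 \<Rightarrow> 'v0)) \<times> ('v1 \<Rightarrow> 'v1) \<times> ('v0 \<Rightarrow> 'v1 \<Rightarrow> 'v1) \<times>
   ('v0 \<Rightarrow> 'v0 \<Rightarrow> 'v0 \<Rightarrow> 'v1) \<Rightarrow> ('v0::zero, 'v1::uminus) HL_data"
where
  "tuple_to_skeletal = (\<lambda>((bracket, \<phi>), A, \<rho>, \<theta>).
     \<lparr>differential = (\<lambda>_. 0), l2_00 = bracket, l2_01 = \<rho>, l2_10 = (\<lambda>m x. - \<rho> x m),
      l2_11 = (\<lambda>_ _. ()), l3 = \<theta>, phi0 = \<phi>, phi1 = A\<rparr>)"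

lemma skeletal_to_tuple_to_skeletal [simp]: "skeletal_to_tuple (tuple_to_skeletal t) = t"
  by (auto simp: skeletal_to_tuple_def tuple_to_skeletal_def split: prod.splits)

text \<open>The two hypotheses recover the forgotten \<open>differential\<close> and
  \<open>l2_10\<close>; the type \<open>unit\<close> recovers \<open>l2_11\<close>.\<close>

lemma tuple_to_skeletal_to_tuple:
  assumes "skeletal L" and "l2_10 L = (\<lambda>m x. - l2_01 L x m)"
  shows "tuple_to_skeletal (skeletal_to_tuple L) = L"
  using assms
  by (cases L) (simp add: skeletal_to_tuple_def tuple_to_skeletal_def skeletal_def fun_eq_iff)

theorem theorem4p2:
  fixes scale0 :: "'k::field_char_0 \<Rightarrow> 'v0::ab_group_add \<Rightarrow> 'v0"
    and scale1 :: "'k \<Rightarrow> 'v1::ab_group_add \<Rightarrow> 'v1"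
  assumes "vector_space scale0" and "vector_space scale1"
  shows "bij_betw skeletal_to_tuple
           (skeletal_HL_infinity_algebras scale0 scale1)
           (hom_Lie_3_cocycle_tuples scale0 scale1)"
proof -
  note iff = skeletal_HL_infinity_iff[OF assms]
  show ?thesis
  proof (rule bij_betw_byWitness[where f' = tuple_to_skeletal])
    show "\<forall>L \<in> skeletal_HL_infinity_algebras scale0 scale1.
        tuple_to_skeletal (skeletal_to_tuple L) = L"
      by (auto simp: skeletal_HL_infinity_algebras_def skeletal_def iff
          intro!: tuple_to_skeletal_to_tuple)
    show "\<forall>t \<in> hom_Lie_3_cocycle_tuples scale0 scale1. skeletal_to_tuple (tuple_to_skeletal t) = t"
      by simp
    show "skeletal_to_tuple ` skeletal_HL_infinity_algebras scale0 scale1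
        \<subseteq> hom_Lie_3_cocycle_tuples scale0 scale1"
      by (auto simp: skeletal_HL_infinity_algebras_def skeletal_def iff)
    show "tuple_to_skeletal ` hom_Lie_3_cocycle_tuples scale0 scale1
        \<subseteq> skeletal_HL_infinity_algebras scale0 scale1"
    proof (rule image_subsetI)
      fix t :: "(('v0 \<Rightarrow> 'v0 \<Rightarrow> 'v0) \<times> ('v0 \<Rightarrow> 'v0)) \<times> ('v1 \<Rightarrow> 'v1) \<times> ('v0 \<Rightarrow> 'v1 \<Rightarrow> 'v1) \<times>
        ('v0 \<Rightarrow> 'v0 \<Rightarrow> 'v0 \<Rightarrow> 'v1)"
      assume t: "t \<in> hom_Lie_3_cocycle_tuples scale0 scale1"
      have diff: "differential (tuple_to_skeletal t) = (\<lambda>_. 0)"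
        and l2_10: "l2_10 (tuple_to_skeletal t) = (\<lambda>m x. - l2_01 (tuple_to_skeletal t) x m)"
        by (auto simp: tuple_to_skeletal_def split: prod.splits)
      \<comment> \<open>By \<open>iff\<close> all axioms reduce to the form of \<open>l2_10\<close>
        and to the tuple of \<open>tuple_to_skeletal t\<close> being admissible; that tuple is
        \<open>t\<close> itself.\<close>
      show "tuple_to_skeletal t \<in> skeletal_HL_infinity_algebras scale0 scale1"
        using t l2_10
        by (simp add: skeletal_HL_infinity_algebras_def skeletal_def diff iff[OF diff])
    qed
  qed
qed

end
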